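(* Let $\mathcal{X}\subseteq\{0,1\}^n$, let $\pmb{b}\in\mathbb{R}^n_+$ and let the support set be $\Xi_{\pmb{0},\pmb{b}}=\{\pmb{\xi}\in\mathbb{R}^n_+:\pmb{0}\le\pmb{\xi}\le\pmb{b}\}$. Let $\hat{\pmb{\xi}}_1,\dots,\hat{\pmb{\xi}}_N\in\Xi_{\pmb{0},\pmb{b}}$ with $\widehat{\mathbb{P}}^N=(\hat{\pmb{\xi}}_1,\dots,\hat{\pmb{\xi}}_N)$ and let $\epsilon\ge0$. If $\alpha=\frac lN$ for some $l\in\{1,\dots,N\}$ and $q=1$, then for each $\pmb{x}\in\mathcal{X}$ $$\max_{\mathbb{P}^N\in\mathcal{B}_\epsilon(\widehat{\mathbb{P}}^N)}{\rm CVaR}^{\alpha}_{\mathbb{P}^N}[\tilde{\pmb{\xi}}^T\pmb{x}]=\min\Big\{\pmb{b}^T\pmb{x},\ {\rm CVaR}^{\alpha}_{\widehat{\mathbb{P}}^N}[\tilde{\pmb{\xi}}^T\pmb{x}]+\frac1l N\epsilon\Big\}.$$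
   Context: The notation $\mathbb{P}^N=(\pmb{\xi}_1,\dots,\pmb{\xi}_N)$ denotes the discrete distribution $\frac1N\sum_{i=1}^N\delta_{\pmb{\xi}_i}$ (repetitions allowed), $\tilde{\pmb{\xi}}$ is a random vector with the distribution indicated in the subscript, and ${\rm CVaR}^{\alpha}_{\mathbb{P}^N}[\tilde{\pmb{\xi}}^T\pmb{x}]=\inf_{t\in\mathbb{R}}\big(t+\frac1{\alpha N}\sum_{i=1}^N\max\{0,\pmb{\xi}_i^T\pmb{x}-t\}\big)$. The ambiguity set (with support set $\Xi=\Xi_{\pmb{0},\pmb{b}}$ and $q$-norm $\|\cdot\|_q$) is $$\mathcal{B}_{\epsilon}(\widehat{\mathbb{P}}^N)=\Big\{(\pmb{\xi}_1,\dots,\pmb{\xi}_N):\ \sum_{i=1}^N\|\pmb{\xi}_i-\hat{\pmb{\xi}}_i\|_q\le N\epsilon,\ \pmb{\xi}_i\in\Xi,\ i=1,\dots,N\Big\}.$$ *)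

theory Defs
  imports "HOL-Analysis.Analysis"
begin

(* Meant for finite q \<ge> 1. *)
definition qnorm :: "real \<Rightarrow> real ^ 'n \<Rightarrow> real" where
  "qnorm q v = (\<Sum>j\<in>UNIV. \<bar>v $ j\<bar> powr q) powr (1 / q)"

(* The order on real ^ 'n is componentwise. *)
definition support_set :: "real ^ 'n \<Rightarrow> real ^ 'n \<Rightarrow> (real ^ 'n) set" where
  "support_set a b = {\<xi>. 0 \<le> \<xi> \<and> a \<le> \<xi> \<and> \<xi> \<le> b}"

(* A discrete distribution (1/N) * (delta_(\<xi> 1) + ... + delta_(\<xi> N)) is given by the tuple
   \<xi> of its atoms, with repetitions allowed. Only the values of \<xi> on {1..N} matter. *)

(* The infimum is over a set that is bounded below whenever 0 < \<alpha> \<le> 1 and N \<ge> 1. *)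
definition CVaR :: "real \<Rightarrow> nat \<Rightarrow> (nat \<Rightarrow> real ^ 'n) \<Rightarrow> real ^ 'n \<Rightarrow> real" where
  "CVaR \<alpha> N \<xi> x =
     (INF t::real. t + 1 / (\<alpha> * real N) * (\<Sum>i=1..N. max 0 (\<xi> i \<bullet> x - t)))"

definition ambiguity_set ::
  "real \<Rightarrow> (real ^ 'n) set \<Rightarrow> nat \<Rightarrow> real \<Rightarrow> (nat \<Rightarrow> real ^ 'n) \<Rightarrow> (nat \<Rightarrow> real ^ 'n) set" where
  "ambiguity_set q \<Xi> N \<epsilon> \<xi>hat =
     {\<xi> \<in> {1..N} \<rightarrow>\<^sub>E \<Xi>. (\<Sum>i=1..N. qnorm q (\<xi> i - \<xi>hat i)) \<le> real N * \<epsilon>}"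

(* "The maximum of f over A exists and equals m". The library's Max is only meaningful
   for finite sets, and Sup would not express attainment. *)
definition is_maximum_on :: "('a \<Rightarrow> real) \<Rightarrow> 'a set \<Rightarrow> real \<Rightarrow> bool" where
  "is_maximum_on f A m \<longleftrightarrow> m \<in> f ` A \<and> (\<forall>a\<in>A. f a \<le> m)"

end

(* For alpha = l/N the CVaR is the mean of the l largest losses. On binary x a loss moves by at
   most the 1-norm of the move of its atom, which gives the upper bound N * epsilon / l on the
   increase; b . x is a bound because no loss exceeds it. For attainment, move the l worst atoms
   towards b on the support of x, all by the same fraction: each unit of 1-norm then raises the
   sum of the l worst losses by one unit, until either the budget is spent or they all reach
   b . x. *)
theory Submission
  imports Defs
begin

lemma qnorm_1: "qnorm 1 v = (\<Sum>j\<in>UNIV. \<bar>v $ j\<bar>)"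
  by (simp add: qnorm_def sum_nonneg)

text \<open>Hoelder's inequality for the pair of the 1-norm and the sup-norm: a 0/1 vector has
  sup-norm at most 1.\<close>

lemma inner_le_qnorm_1:
  fixes v x :: "real ^ 'n"
  assumes "\<And>j. x $ j \<in> {0, 1}"
  shows "v \<bullet> x \<le> qnorm 1 v"
  unfolding qnorm_1 inner_vec_def
proof (rule sum_mono)
  fix j
  show "v $ j \<bullet> x $ j \<le> \<bar>v $ j\<bar>" using assms[of j] by auto
qed

lemma inner_left_mono_vec:
  fixes u v x :: "real ^ 'n"
  assumes "u \<le> v" "0 \<le> x"
  shows "u \<bullet> x \<le> v \<bullet> x"
  using assms unfolding inner_vec_def
  by (auto intro!: sum_mono mult_right_mono simp: less_eq_vec_def)

text \<open>Selects the \<open>l\<close> largest values without sorting: a threshold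
  \<open>t\<close> separates them from the rest, and ties at \<open>t\<close> may fall on either
  side. Induction moves a maximiser of the remaining values into \<open>S\<close> and takes its
  value as the new threshold.\<close>

lemma obtain_top_set:
  fixes y :: "'a \<Rightarrow> real"
  assumes "finite A" "l \<le> card A"
  obtains S t where "S \<subseteq> A" "card S = l" "\<And>i. i \<in> S \<Longrightarrow> t \<le> y i" "\<And>i. i \<in> A - S \<Longrightarrow> y i \<le> t"
proof -
  have "\<exists>S t. S \<subseteq> A \<and> card S = l \<and> (\<forall>i\<in>S. t \<le> y i) \<and> (\<forall>i\<in>A - S. y i \<le> t)"
    using assms(2)
  proof (induction l)
    case 0
    \<comment> \<open>For empty \<open>A\<close> the value of \<open>Max\<close> is unspecified, but
      the bound is then vacuous.\<close>
    have "\<exists>t. \<forall>i\<in>A. y i \<le> t"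
      using assms(1) by (intro exI[of _ "Max (y ` A)"]) auto
    then show ?case by (intro exI[of _ "{}"]) auto
  next
    case (Suc l)
    then obtain S t where S: "S \<subseteq> A" "card S = l" "\<forall>i\<in>S. t \<le> y i" "\<forall>i\<in>A - S. y i \<le> t"
      by (metis Suc_leD)
    have fin: "finite S" "finite (A - S)" using S(1) assms(1) finite_subset by auto
    have "A - S \<noteq> {}" using S(1,2) Suc.prems by auto
    then have "Max (y ` (A - S)) \<in> y ` (A - S)" using fin by (intro Max_in) auto
    then obtain m where m: "m \<in> A - S" "y m = Max (y ` (A - S))" by auto
    have top: "\<forall>i\<in>A - S. y i \<le> y m"
      unfolding m(2) using fin by (auto intro!: Max_ge)
    have "insert m S \<subseteq> A" "card (insert m S) = Suc l" using S m fin by auto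
    moreover have "\<forall>i\<in>insert m S. y m \<le> y i" using S m by force
    ultimately show ?case using top by blast
  qed
  then show ?thesis using that by blast
qed

text \<open>Each \<open>y i - t\<close> is at most its positive part, and the positive parts outside
  \<open>S\<close> only add to the sum. This is weak duality: any \<open>l\<close> losses, not only
  the worst ones, bound the objective from below at every \<open>t\<close>.\<close>

lemma mean_le_CVaR_objective:
  fixes y :: "nat \<Rightarrow> real"
  assumes "S \<subseteq> {1..N}" "card S = l" "0 < l"
  shows "1 / real l * (\<Sum>i\<in>S. y i) \<le> t + 1 / real l * (\<Sum>i=1..N. max 0 (y i - t))"
proof -
  have "(\<Sum>i\<in>S. y i) - real l * t = (\<Sum>i\<in>S. y i - t)"
    using assms(2) by (simp add: sum_subtractf)
  also have "\<dots> \<le> (\<Sum>i\<in>S. max 0 (y i - t))" by (intro sum_mono) auto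
  also have "\<dots> \<le> (\<Sum>i=1..N. max 0 (y i - t))"
    using assms(1) by (intro sum_mono2) auto
  finally show ?thesis using assms(3) by (simp add: field_simps)
qed

context
  fixes N l :: nat and \<alpha> :: real
  assumes l: "l \<in> {1..N}" and \<alpha>: "\<alpha> = real l / real N"
begin

lemma CVaR_eq:
  "CVaR \<alpha> N \<xi> x = (INF t. t + 1 / real l * (\<Sum>i=1..N. max 0 (\<xi> i \<bullet> x - t)))"
proof -
  have "\<alpha> * real N = real l" using l \<alpha> by auto
  then show ?thesis by (simp add: CVaR_def)
qed

lemma mean_le_CVaR:
  assumes "S \<subseteq> {1..N}" "card S = l"
  shows "1 / real l * (\<Sum>i\<in>S. \<xi> i \<bullet> x) \<le> CVaR \<alpha> N \<xi> x"
  unfolding CVaR_eq using l by (intro cINF_greatest mean_le_CVaR_objective assms) auto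

lemma CVaR_le:
  "CVaR \<alpha> N \<xi> x \<le> t + 1 / real l * (\<Sum>i=1..N. max 0 (\<xi> i \<bullet> x - t))"
  unfolding CVaR_eq
proof (rule cINF_lower)
  \<comment> \<open>Any \<open>l\<close> indices give a lower bound; the first \<open>l\<close> are
    an arbitrary choice.\<close>
  show "bdd_below (range (\<lambda>t. t + 1 / real l * (\<Sum>i=1..N. max 0 (\<xi> i \<bullet> x - t))))"
    using l by (intro bdd_belowI2[where m = "1 / real l * (\<Sum>i=1..l. \<xi> i \<bullet> x)"]
        mean_le_CVaR_objective) auto
qed auto

text \<open>The threshold of the top set minimises the objective: there the positive parts vanish
  outside \<open>S\<close> and equal the plain differences on \<open>S\<close>, so \<open>t\<close>
  cancels and the lower bound is met.\<close>

lemma CVaR_eq_mean_of_worst: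
  obtains S where "S \<subseteq> {1..N}" "card S = l" "CVaR \<alpha> N \<xi> x = 1 / real l * (\<Sum>i\<in>S. \<xi> i \<bullet> x)"
proof -
  obtain S t where S: "S \<subseteq> {1..N}" "card S = l"
    and t: "\<And>i. i \<in> S \<Longrightarrow> t \<le> \<xi> i \<bullet> x" "\<And>i. i \<in> {1..N} - S \<Longrightarrow> \<xi> i \<bullet> x \<le> t"
    using obtain_top_set[of "{1..N}" l "\<lambda>i. \<xi> i \<bullet> x"] l by auto
  have "(\<Sum>i=1..N. max 0 (\<xi> i \<bullet> x - t)) = (\<Sum>i\<in>S. \<xi> i \<bullet> x - t)"
    using S t by (intro sum.mono_neutral_cong_right) (auto intro!: max_absorb1 max_absorb2)
  also have "\<dots> = (\<Sum>i\<in>S. \<xi> i \<bullet> x) - real l * t"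
    using S by (simp add: sum_subtractf)
  finally have "CVaR \<alpha> N \<xi> x \<le> 1 / real l * (\<Sum>i\<in>S. \<xi> i \<bullet> x)"
    using CVaR_le[of \<xi> x t] l by (simp add: field_simps)
  then show ?thesis using that[OF S] mean_le_CVaR[OF S, of \<xi> x] by simp
qed

lemma CVaR_le_bound:
  assumes "\<And>i. i \<in> {1..N} \<Longrightarrow> \<xi> i \<bullet> x \<le> c"
  shows "CVaR \<alpha> N \<xi> x \<le> c"
proof -
  have "(\<Sum>i=1..N. max 0 (\<xi> i \<bullet> x - c)) = 0"
    using assms by (intro sum.neutral) (auto intro!: max_absorb1)
  then show ?thesis using CVaR_le[of \<xi> x c] by simp
qed

text \<open>The positive part is 1-Lipschitz, so at each fixed \<open>t\<close> the two objectives
  can be compared term by term; the infimum is taken only afterwards.\<close>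

lemma CVaR_le_perturbed:
  assumes x: "\<And>j. x $ j \<in> {0, 1}"
    and budget: "(\<Sum>i=1..N. qnorm 1 (\<xi> i - \<zeta> i)) \<le> d"
  shows "CVaR \<alpha> N \<xi> x \<le> CVaR \<alpha> N \<zeta> x + 1 / real l * d"
proof -
  have "CVaR \<alpha> N \<xi> x - 1 / real l * d \<le> CVaR \<alpha> N \<zeta> x"
    unfolding CVaR_eq[of \<zeta>]
  proof (rule cINF_greatest)
    fix t
    have "max 0 (\<xi> i \<bullet> x - t) \<le> max 0 (\<zeta> i \<bullet> x - t) + qnorm 1 (\<xi> i - \<zeta> i)" for i
    proof -
      have "0 \<le> qnorm 1 (\<xi> i - \<zeta> i)" by (simp add: qnorm_1 sum_nonneg)
      moreover have "\<xi> i \<bullet> x - \<zeta> i \<bullet> x \<le> qnorm 1 (\<xi> i - \<zeta> i)"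
        using inner_le_qnorm_1[OF x, of "\<xi> i - \<zeta> i"] by (simp add: inner_diff_left)
      ultimately show ?thesis by linarith
    qed
    then have "(\<Sum>i=1..N. max 0 (\<xi> i \<bullet> x - t))
        \<le> (\<Sum>i=1..N. max 0 (\<zeta> i \<bullet> x - t) + qnorm 1 (\<xi> i - \<zeta> i))"
      by (intro sum_mono)
    also have "\<dots> \<le> (\<Sum>i=1..N. max 0 (\<zeta> i \<bullet> x - t)) + d"
      using budget by (simp add: sum.distrib)
    finally have "1 / real l * (\<Sum>i=1..N. max 0 (\<xi> i \<bullet> x - t))
        \<le> 1 / real l * ((\<Sum>i=1..N. max 0 (\<zeta> i \<bullet> x - t)) + d)"
      by (intro mult_left_mono) auto
    then show "CVaR \<alpha> N \<xi> x - 1 / real l * d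
        \<le> t + 1 / real l * (\<Sum>i=1..N. max 0 (\<zeta> i \<bullet> x - t))"
      using CVaR_le[of \<xi> x t] by (simp add: distrib_left)
  qed auto
  then show ?thesis by simp
qed

end

text \<open>The factor \<open>x $ j\<close> freezes the coordinates outside the support of
  \<open>x\<close>, where a move would cost budget without changing the loss. On the support,
  \<open>c\<close> runs from no move at 0 to \<open>b\<close> itself at 1.\<close>

definition shift_towards :: "real ^ 'n \<Rightarrow> real ^ 'n \<Rightarrow> real \<Rightarrow> real ^ 'n \<Rightarrow> real ^ 'n" where
  "shift_towards b x c v = (\<chi> j. v $ j + c * ((b $ j - v $ j) * x $ j))"

lemma inner_shift_towards:
  fixes x :: "real ^ 'n"
  assumes "\<And>j. x $ j \<in> {0, 1}"
  shows "shift_towards b x c v \<bullet> x = v \<bullet> x + c * ((b - v) \<bullet> x)"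
proof -
  have "shift_towards b x c v $ j * x $ j = v $ j * x $ j + c * ((b $ j - v $ j) * x $ j)" for j
    using assms[of j] by (auto simp: shift_towards_def)
  then show ?thesis by (simp add: inner_vec_def sum.distrib sum_distrib_left)
qed

text \<open>No coordinate decreases, so the absolute values drop out. The cost is exactly the gain
  in \<open>inner_shift_towards\<close>: no budget is wasted.\<close>

lemma qnorm_1_shift_towards:
  fixes x :: "real ^ 'n"
  assumes "\<And>j. x $ j \<in> {0, 1}" "v \<le> b" "0 \<le> c"
  shows "qnorm 1 (shift_towards b x c v - v) = c * ((b - v) \<bullet> x)"
proof -
  have "\<bar>(shift_towards b x c v - v) $ j\<bar> = c * ((b $ j - v $ j) * x $ j)" for j
    using assms(1)[of j] assms(2,3) by (auto simp: shift_towards_def less_eq_vec_def)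
  then show ?thesis by (simp add: qnorm_1 inner_vec_def sum_distrib_left)
qed

lemma shift_towards_in_support_set:
  fixes x :: "real ^ 'n"
  assumes "\<And>j. x $ j \<in> {0, 1}" "v \<in> support_set 0 b" "0 \<le> c" "c \<le> 1"
  shows "shift_towards b x c v \<in> support_set 0 b"
proof -
  have "0 \<le> shift_towards b x c v $ j \<and> shift_towards b x c v $ j \<le> b $ j" for j
  proof -
    have v: "0 \<le> v $ j" "v $ j \<le> b $ j"
      using assms(2) by (auto simp: support_set_def less_eq_vec_def)
    have "0 \<le> c * (b $ j - v $ j)" "c * (b $ j - v $ j) \<le> b $ j - v $ j"
      using v assms(3,4) by (auto intro: mult_left_le_one_le)
    then show ?thesis
      using v assms(1)[of j] by (auto simp: shift_towards_def)
  qed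
  then show ?thesis by (simp add: support_set_def less_eq_vec_def)
qed

theorem proposition4:
  fixes X :: "(real ^ 'n) set"
    and b :: "real ^ 'n"
    and \<xi>hat :: "nat \<Rightarrow> real ^ 'n"
    and N l :: nat
    and \<epsilon> \<alpha> q :: real
  assumes "X \<subseteq> {x. \<forall>j. x $ j \<in> {0, 1}}"
    and "0 \<le> b"
    and "\<forall>i\<in>{1..N}. \<xi>hat i \<in> support_set 0 b"
    and "0 \<le> \<epsilon>"
    and "l \<in> {1..N}"
    and "\<alpha> = real l / real N"
    and "q = 1"
  shows "\<forall>x\<in>X. is_maximum_on (\<lambda>\<xi>. CVaR \<alpha> N \<xi> x)
           (ambiguity_set q (support_set 0 b) N \<epsilon> \<xi>hat)
           (min (b \<bullet> x) (CVaR \<alpha> N \<xi>hat x + 1 / real l * real N * \<epsilon>))"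
proof
  fix x assume "x \<in> X"
  then have x01: "\<And>j. x $ j \<in> {0, 1}" using assms(1) by blast
  have x0: "0 \<le> x"
    unfolding less_eq_vec_def
  proof
    fix j
    show "0 $ j \<le> x $ j" using x01[of j] by auto
  qed
  note la = assms(5,6)
  let ?B = "ambiguity_set q (support_set 0 b) N \<epsilon> \<xi>hat"
  let ?m = "min (b \<bullet> x) (CVaR \<alpha> N \<xi>hat x + 1 / real l * real N * \<epsilon>)"
  have upper: "CVaR \<alpha> N \<xi> x \<le> ?m" if "\<xi> \<in> ?B" for \<xi>
  proof -
    have \<xi>: "\<And>i. i \<in> {1..N} \<Longrightarrow> \<xi> i \<in> support_set 0 b"
      and d: "(\<Sum>i=1..N. qnorm 1 (\<xi> i - \<xi>hat i)) \<le> real N * \<epsilon>"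
      using that assms(7) by (auto simp: ambiguity_set_def)
    have "CVaR \<alpha> N \<xi> x \<le> b \<bullet> x"
      using \<xi> by (intro CVaR_le_bound[OF la] inner_left_mono_vec x0) (auto simp: support_set_def)
    then show ?thesis using CVaR_le_perturbed[OF la x01 d] by (simp add: mult.assoc)
  qed
  obtain S where S: "S \<subseteq> {1..N}" "card S = l"
    and hat: "CVaR \<alpha> N \<xi>hat x = 1 / real l * (\<Sum>i\<in>S. \<xi>hat i \<bullet> x)"
    using CVaR_eq_mean_of_worst[OF la] by blast
  have hat_b: "\<xi>hat i \<le> b" if "i \<in> {1..N}" for i
    using assms(3) that by (auto simp: support_set_def)
  \<comment> \<open>\<open>D\<close> is both the cost of moving the worst atoms all the way to
    \<open>b\<close> on the support of \<open>x\<close> and the total increase in loss that this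
    yields.\<close>
  define D where "D = (\<Sum>i\<in>S. (b - \<xi>hat i) \<bullet> x)"
  have D_eq: "D = real l * (b \<bullet> x) - (\<Sum>i\<in>S. \<xi>hat i \<bullet> x)"
    using S by (simp add: D_def inner_diff_left sum_subtractf)
  \<comment> \<open>The largest fraction in [0, 1] that the budget affords. In the second branch
    \<open>D\<close> exceeds a nonnegative number, so the division is safe.\<close>
  define c where "c = (if D \<le> real N * \<epsilon> then 1 else real N * \<epsilon> / D)"
  have N\<epsilon>: "0 \<le> real N * \<epsilon>" using assms(4) by simp
  have c: "0 \<le> c" "c \<le> 1" "c * D \<le> real N * \<epsilon>"
    using N\<epsilon> by (auto simp: c_def)
  \<comment> \<open>The restriction to \<open>{1..N}\<close> makes the tuple extensional, as
    membership in the ambiguity set demands.\<close>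
  define \<xi> where "\<xi> = (\<lambda>i\<in>{1..N}. if i \<in> S then shift_towards b x c (\<xi>hat i) else \<xi>hat i)"
  have "(\<Sum>i=1..N. qnorm 1 (\<xi> i - \<xi>hat i)) = (\<Sum>i\<in>S. c * ((b - \<xi>hat i) \<bullet> x))"
  proof (rule sum.mono_neutral_cong_right)
    fix i assume "i \<in> S"
    then show "qnorm 1 (\<xi> i - \<xi>hat i) = c * ((b - \<xi>hat i) \<bullet> x)"
      using S(1) qnorm_1_shift_towards[OF x01 hat_b c(1), of i] by (auto simp: \<xi>_def)
  qed (use S(1) in \<open>auto simp: \<xi>_def qnorm_1\<close>)
  also have "\<dots> = c * D" by (simp add: D_def sum_distrib_left)
  finally have "\<xi> \<in> ?B"
    using c assms(3,7) shift_towards_in_support_set[OF x01 _ c(1,2)]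
    by (auto simp: ambiguity_set_def \<xi>_def)
  \<comment> \<open>By weak duality the mean over the old index set \<open>S\<close> suffices here;
    whether \<open>S\<close> still carries the worst losses after the shift need not be
    checked.\<close>
  moreover have "?m \<le> CVaR \<alpha> N \<xi> x"
  proof -
    have "(\<Sum>i\<in>S. \<xi> i \<bullet> x) = (\<Sum>i\<in>S. \<xi>hat i \<bullet> x + c * ((b - \<xi>hat i) \<bullet> x))"
      using S(1) by (intro sum.cong) (auto simp: \<xi>_def inner_shift_towards[OF x01])
    also have "\<dots> = (\<Sum>i\<in>S. \<xi>hat i \<bullet> x) + c * D"
      by (simp add: D_def sum.distrib sum_distrib_left)
    finally have *: "1 / real l * ((\<Sum>i\<in>S. \<xi>hat i \<bullet> x) + c * D) \<le> CVaR \<alpha> N \<xi> x"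
      using mean_le_CVaR[OF la S, of \<xi> x] by simp
    show ?thesis
    proof (cases "D \<le> real N * \<epsilon>")
      case True
      then have "1 / real l * ((\<Sum>i\<in>S. \<xi>hat i \<bullet> x) + c * D) = b \<bullet> x"
        using assms(5) by (simp add: c_def D_eq)
      then show ?thesis using * by simp
    next
      case False
      then have "c * D = real N * \<epsilon>" using N\<epsilon> by (simp add: c_def)
      then show ?thesis using * hat by (simp add: distrib_left mult.assoc add_divide_distrib)
    qed
  qed
  ultimately show "is_maximum_on (\<lambda>\<xi>. CVaR \<alpha> N \<xi> x) ?B ?m"
    unfolding is_maximum_on_def using upper by (metis antisym image_eqI)
qed

end
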